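(* The positive rigid color vectors, modulo the action of $S_3$ on the colors, are the non-constant vectors $\mathbf c$ that sum to $1$ and for which no prefix sums to $3$. Precisely: for $n\ge2$, a vector $\mathbf c=(c_1,\dots,c_n)$ with entries in $\{1,2,3\}$ is a positive rigid color vector with root color $1$ if and only if $\mathbf c$ is non-constant, $c_1+\cdots+c_n=1$, and $c_1+\cdots+c_j\neq 3$ for every $j$ with $1\le j\le n$.
   Context: **Trees.** Finite binary trees are rooted, planar; every vertex has $0$ or two (ordered: left, right) children except the root $*$, which has degree $1$ and a single child $\emptyset$. Leaves are numbered left to right; internal vertices are the vertices of degree $3$. The root edge joins $*$ and $\emptyset$. **Colors.** Colors are elements of $\mathbb Z_2\times\mathbb Z_2$, coded $0=(0,0)$, $1=(0,1)$, $2=(1,0)$, $3=(1,1)$, and sums are taken in this group. $S_3$ acts by permuting $1,2,3$. A color vector $\mathbf c=(c_1,\dots,c_n)$ for a tree with $n$ leaves determines the unique edge coloring in which the edge at the $i$-th leaf has color $c_i$ and the three edges at each internal vertex sum to $0$; the root color is the color of the root edge and equals the sum of the entries of $\mathbf c$. The vector is valid for the tree if this is a proper edge coloring using only colors $1,2,3$. **Signs and rigidity.** A valid color vector gives each internal vertex a derived sign: $+$ if the colors of its (parent edge, left child edge, right child edge) form a cyclic permutation of $(1,2,3)$, and $-$ otherwise. A sign assignment is rigid if any two adjacent internal vertices have opposite signs, and positive rigid if moreover the top internal vertex $\emptyset$ is positive. A color vector $\mathbf c$ is positive rigid if it is valid for some finite binary tree and its derived sign assignment is positive rigid on one (equivalently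 every) tree for which it is valid. Each $S_3$-orbit containing a positive rigid vector contains exactly one positive rigid vector with root color $1$. *)

theory Defs
  imports Main "HOL-Library.Z2" "HOL-Library.Product_Plus" "HOL-Combinatorics.Permutations"
begin

text \<open>The tree consists of the root \<open>*\<close> together with the value of this type hanging below it
  along the root edge; \<open>Leaf\<close> is the tree whose only edge is the root edge.\<close>

datatype btree = Leaf | Node btree btree

text \<open>Vertices other than \<open>*\<close> are addressed by the path leading to them from the child
  \<open>[]\<close> of \<open>*\<close>. An edge is identified with its lower end point, so an edge coloring is a function
  on addresses and \<open>[]\<close> also stands for the root edge.\<close>

datatype dir = L | R

type_synonym vertex = "dir list"

fun vertices :: "btree \<Rightarrow> vertex set" where
  "vertices Leaf = {[]}"
| "vertices (Node l r) = insert [] (Cons L ` vertices l \<union> Cons R ` vertices r)"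

fun internal :: "btree \<Rightarrow> vertex set" where
  "internal Leaf = {}"
| "internal (Node l r) = insert [] (Cons L ` internal l \<union> Cons R ` internal r)"

fun leaves :: "btree \<Rightarrow> vertex list" where
  "leaves Leaf = [[]]"
| "leaves (Node l r) = map (Cons L) (leaves l) @ map (Cons R) (leaves r)"

abbreviation num_leaves :: "btree \<Rightarrow> nat" where
  "num_leaves t \<equiv> length (leaves t)"

type_synonym color = "bit \<times> bit"

abbreviation col1 :: color where "col1 \<equiv> (0, 1)"
abbreviation col2 :: color where "col2 \<equiv> (1, 0)"
abbreviation col3 :: color where "col3 \<equiv> (1, 1)"

abbreviation colors123 :: "color set" where
  "colors123 \<equiv> {col1, col2, col3}"

definition is_edge_coloring :: "btree \<Rightarrow> color list \<Rightarrow> (vertex \<Rightarrow> color) \<Rightarrow> bool" where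
  "is_edge_coloring t c \<kappa> \<longleftrightarrow>
     (\<forall>i < num_leaves t. \<kappa> (leaves t ! i) = c ! i) \<and>
     (\<forall>v \<in> internal t. \<kappa> v + \<kappa> (v @ [L]) + \<kappa> (v @ [R]) = 0)"

text \<open>The value 0 outside the tree only serves to make the function unique. The description is
  meaningful when \<open>length c = num_leaves t\<close>; see \<open>edge_coloring_unique_exists\<close> below.\<close>

definition edge_coloring :: "btree \<Rightarrow> color list \<Rightarrow> vertex \<Rightarrow> color" where
  "edge_coloring t c =
     (THE \<kappa>. is_edge_coloring t c \<kappa> \<and> (\<forall>v. v \<notin> vertices t \<longrightarrow> \<kappa> v = 0))"

definition root_color :: "btree \<Rightarrow> color list \<Rightarrow> color" where
  "root_color t c = edge_coloring t c []"

text \<open>Two distinct edges can only meet at an internal vertex, which yields the properness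
  condition used here.\<close>

definition valid :: "btree \<Rightarrow> color list \<Rightarrow> bool" where
  "valid t c \<longleftrightarrow> length c = num_leaves t \<and>
     (\<forall>v \<in> vertices t. edge_coloring t c v \<in> colors123) \<and>
     (\<forall>v \<in> internal t.
        distinct [edge_coloring t c v, edge_coloring t c (v @ [L]), edge_coloring t c (v @ [R])])"

datatype sign = Plus | Minus

definition derived_sign :: "btree \<Rightarrow> color list \<Rightarrow> vertex \<Rightarrow> sign" where
  "derived_sign t c v =
     (if (edge_coloring t c v, edge_coloring t c (v @ [L]), edge_coloring t c (v @ [R]))
           \<in> {(col1, col2, col3), (col2, col3, col1), (col3, col1, col2)}
      then Plus else Minus)"

definition rigid :: "btree \<Rightarrow> (vertex \<Rightarrow> sign) \<Rightarrow> bool" where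
  "rigid t s \<longleftrightarrow>
     (\<forall>v d. v \<in> internal t \<and> v @ [d] \<in> internal t \<longrightarrow> s v \<noteq> s (v @ [d]))"

definition positive_rigid :: "btree \<Rightarrow> (vertex \<Rightarrow> sign) \<Rightarrow> bool" where
  "positive_rigid t s \<longleftrightarrow> rigid t s \<and> [] \<in> internal t \<and> s [] = Plus"

definition positive_rigid_on :: "btree \<Rightarrow> color list \<Rightarrow> bool" where
  "positive_rigid_on t c \<longleftrightarrow> valid t c \<and> positive_rigid t (derived_sign t c)"

definition positive_rigid_vector :: "color list \<Rightarrow> bool" where
  "positive_rigid_vector c \<longleftrightarrow> (\<exists>t. positive_rigid_on t c)"

text \<open>The tree is quantified since the root color is by definition the color of an edge of a tree;
  by \<open>root_color_eq_sum_list\<close> below it does not depend on the tree.\<close>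

definition positive_rigid_vector_with_root_color :: "color list \<Rightarrow> color \<Rightarrow> bool" where
  "positive_rigid_vector_with_root_color c k \<longleftrightarrow>
     (\<exists>t. positive_rigid_on t c \<and> root_color t c = k)"

definition S3_orbit :: "color list \<Rightarrow> color list set" where
  "S3_orbit c = {map \<pi> c | \<pi>. \<pi> permutes colors123}"

lemma is_edge_coloring_Node:
  assumes "length c = num_leaves (Node l r)"
  shows "is_edge_coloring (Node l r) c \<kappa> \<longleftrightarrow>
    is_edge_coloring l (take (num_leaves l) c) (\<lambda>w. \<kappa> (L # w)) \<and>
    is_edge_coloring r (drop (num_leaves l) c) (\<lambda>w. \<kappa> (R # w)) \<and>
    \<kappa> [] + \<kappa> [L] + \<kappa> [R] = 0"
proof -
  let ?m = "num_leaves l" and ?n = "num_leaves r"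
  have split: "(\<forall>i < ?m + ?n. P i) \<longleftrightarrow> (\<forall>i < ?m. P i) \<and> (\<forall>i < ?n. P (?m + i))" for P
  proof (intro iffI conjI allI impI)
    fix i assume *: "(\<forall>i < ?m. P i) \<and> (\<forall>i < ?n. P (?m + i))" and i: "i < ?m + ?n"
    show "P i"
    proof (cases "i < ?m")
      case False
      then have "i = ?m + (i - ?m)" "i - ?m < ?n" using i by simp_all
      then show ?thesis using * by metis
    qed (use * in blast)
  qed simp_all
  have "(\<forall>i < num_leaves (Node l r). \<kappa> (leaves (Node l r) ! i) = c ! i) \<longleftrightarrow>
      (\<forall>i < ?m. \<kappa> (L # leaves l ! i) = c ! i) \<and> (\<forall>i < ?n. \<kappa> (R # leaves r ! i) = c ! (?m + i))"
    using split[of "\<lambda>i. \<kappa> (leaves (Node l r) ! i) = c ! i"] by (simp add: nth_append)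
  moreover have "(\<forall>v \<in> internal (Node l r). \<kappa> v + \<kappa> (v @ [L]) + \<kappa> (v @ [R]) = 0) \<longleftrightarrow>
      (\<forall>v \<in> internal l. \<kappa> (L # v) + \<kappa> (L # v @ [L]) + \<kappa> (L # v @ [R]) = 0) \<and>
      (\<forall>v \<in> internal r. \<kappa> (R # v) + \<kappa> (R # v @ [L]) + \<kappa> (R # v @ [R]) = 0) \<and>
      \<kappa> [] + \<kappa> [L] + \<kappa> [R] = 0"
    by (simp add: ball_Un conj_ac)
  ultimately show ?thesis
    using assms unfolding is_edge_coloring_def by simp blast
qed

lemma color_sum_zero_iff: "(a::color) + b + c = 0 \<longleftrightarrow> a = b + c"
proof -
  have "x + x = 0" for x :: color
    by (cases x) (simp add: zero_prod_def)
  then have "- (b + c) = b + c"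
    by (rule minus_unique)
  then show ?thesis
    by (metis add.assoc eq_neg_iff_add_eq_0)
qed

lemma edge_coloring_unique_exists:
  assumes "length c = num_leaves t"
  shows "\<exists>!\<kappa>. is_edge_coloring t c \<kappa> \<and> (\<forall>v. v \<notin> vertices t \<longrightarrow> \<kappa> v = 0)"
  using assms
proof (induction t arbitrary: c)
  case Leaf
  show ?case
    by (rule ex1I[of _ "\<lambda>v. if v = [] then c ! 0 else 0"]) (auto simp: is_edge_coloring_def)
next
  case (Node l r)
  let ?Q = "\<lambda>t c \<kappa>. is_edge_coloring t c \<kappa> \<and> (\<forall>v. v \<notin> vertices t \<longrightarrow> \<kappa> v = 0)"
  let ?cl = "take (num_leaves l) c" and ?cr = "drop (num_leaves l) c"
  have iff: "?Q (Node l r) c \<kappa> \<longleftrightarrow> ?Q l ?cl (\<lambda>w. \<kappa> (L # w)) \<and> ?Q r ?cr (\<lambda>w. \<kappa> (R # w)) \<and>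
      \<kappa> [] = \<kappa> [L] + \<kappa> [R]" for \<kappa>
  proof -
    have "(\<forall>v. v \<notin> vertices (Node l r) \<longrightarrow> \<kappa> v = 0) \<longleftrightarrow>
        (\<forall>w. w \<notin> vertices l \<longrightarrow> \<kappa> (L # w) = 0) \<and> (\<forall>w. w \<notin> vertices r \<longrightarrow> \<kappa> (R # w) = 0)"
      (is "?A \<longleftrightarrow> ?B")
    proof
      assume ?A then show ?B by auto
    next
      assume B: ?B
      show ?A
      proof (intro allI impI)
        fix v assume v: "v \<notin> vertices (Node l r)"
        show "\<kappa> v = 0"
        proof (cases v)
          case Nil then show ?thesis using v by simp
        next
          case (Cons d w) then show ?thesis using v B by (cases d) auto
        qed
      qed
    qed
    then show ?thesis
      by (simp only: is_edge_coloring_Node[OF Node.prems] color_sum_zero_iff) blast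
  qed
  have "\<exists>!\<kappa>. ?Q l ?cl \<kappa>" "\<exists>!\<kappa>. ?Q r ?cr \<kappa>"
    using Node.prems by (auto intro!: Node.IH)
  then obtain \<kappa>l \<kappa>r where l: "?Q l ?cl \<kappa>l" "\<And>\<kappa>. ?Q l ?cl \<kappa> \<Longrightarrow> \<kappa> = \<kappa>l"
    and r: "?Q r ?cr \<kappa>r" "\<And>\<kappa>. ?Q r ?cr \<kappa> \<Longrightarrow> \<kappa> = \<kappa>r"
    by blast
  define \<kappa> where "\<kappa> v = (case v of [] \<Rightarrow> \<kappa>l [] + \<kappa>r [] | d # w \<Rightarrow> (case d of L \<Rightarrow> \<kappa>l w | R \<Rightarrow> \<kappa>r w))" for v
  show ?case
  proof (rule ex1I[of _ \<kappa>])
    show "?Q (Node l r) c \<kappa>"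
      unfolding iff using l(1) r(1) by (simp add: \<kappa>_def)
  next
    fix \<kappa>' assume *: "?Q (Node l r) c \<kappa>'"
    then have eq: "(\<lambda>w. \<kappa>' (L # w)) = \<kappa>l" "(\<lambda>w. \<kappa>' (R # w)) = \<kappa>r" "\<kappa>' [] = \<kappa>' [L] + \<kappa>' [R]"
      unfolding iff using l(2) r(2) by blast+
    show "\<kappa>' = \<kappa>"
    proof
      fix v
      show "\<kappa>' v = \<kappa> v"
      proof (cases v)
        case Nil
        then show ?thesis using eq fun_cong[OF eq(1), of "[]"] fun_cong[OF eq(2), of "[]"]
          by (simp add: \<kappa>_def)
      next
        case (Cons d w)
        then show ?thesis using fun_cong[OF eq(1), of w] fun_cong[OF eq(2), of w]
          by (cases d) (simp_all add: \<kappa>_def)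
      qed
    qed
  qed
qed

lemma is_edge_coloring_root:
  assumes "length c = num_leaves t" "is_edge_coloring t c \<kappa>"
  shows "\<kappa> [] = sum_list c"
  using assms
proof (induction t arbitrary: c \<kappa>)
  case Leaf
  then show ?case
    by (cases c) (auto simp: is_edge_coloring_def)
next
  case (Node l r)
  let ?cl = "take (num_leaves l) c" and ?cr = "drop (num_leaves l) c"
  have "is_edge_coloring l ?cl (\<lambda>w. \<kappa> (L # w))" "is_edge_coloring r ?cr (\<lambda>w. \<kappa> (R # w))"
    and "\<kappa> [] = \<kappa> [L] + \<kappa> [R]"
    using Node.prems(2) unfolding is_edge_coloring_Node[OF Node.prems(1)] color_sum_zero_iff
    by blast+
  moreover have "length ?cl = num_leaves l" "length ?cr = num_leaves r"
    using Node.prems(1) by simp_all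
  ultimately have "\<kappa> [] = sum_list ?cl + sum_list ?cr"
    using Node.IH by metis
  then show ?case
    by (metis append_take_drop_id sum_list_append)
qed

lemma root_color_eq_sum_list:
  assumes "length c = num_leaves t"
  shows "root_color t c = sum_list c"
  unfolding root_color_def edge_coloring_def
  using theI'[OF edge_coloring_unique_exists[OF assms]] is_edge_coloring_root[OF assms] by blast

end

theory Submission
  imports Defs
begin

text \<open>
  Rigidity turns colored trees into derivations of a context-free grammar. Consider an internal
  vertex whose parent, left and right edges have the colors \<open>k\<close>, \<open>a\<close>, \<open>b\<close>. If its left child is
  internal, the two edges below that child have the colors \<open>k\<close> and \<open>b\<close>, and the opposite sign forces
  the order \<open>k, b\<close>, because exchanging the first two entries of \<open>(k, a, b)\<close> reverses its cyclic
  orientation. In the same way the right child must carry \<open>(b, a, k)\<close>. So the color vectors of the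
  rigid trees whose top carries \<open>(k, a, b)\<close> form the language \<open>W(k, a, b)\<close> with
  \<open>W(k, a, b) = {k} \<union> W(a, k, b) W(b, a, k)\<close>, which is \<open>rigid_word_iff\<close>.

  This language consists of the one-letter word \<open>k\<close> and the non-constant words that sum to \<open>k\<close> and
  have no prefix with sum \<open>b\<close>. The invariant is stable under the production because the forbidden
  sums agree: a prefix of \<open>u v\<close> with sum \<open>b\<close> is either such a prefix of \<open>u \<in> W(a, k, b)\<close>, where \<open>b\<close> is
  again forbidden, or it extends \<open>u\<close> by a prefix of \<open>v \<in> W(b, a, k)\<close> with sum \<open>a + b = k\<close>, which is
  forbidden there. Conversely, the prefix sums of such a word walk in \<open>{0, k, a}\<close>; if \<open>a\<close> were
  avoided too, every step would be \<open>k\<close> and the word constant. Cutting at a visit to \<open>a\<close> gives two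
  factors that satisfy the sum conditions, and \<open>admissible_split\<close> shows that for a suitable visit
  neither factor is constant of length at least two. Induction on the length yields a tree.

  With \<open>(k, a, b) = (1, 2, 3)\<close> this is the first claim. For the bijection, the colors
  \<open>(k, a, b)\<close> at the top of a positive rigid tree are a cyclic rotation of \<open>(1, 2, 3)\<close>, so a rotation
  of the colors moves its vector to root color 1. Conversely, a color permutation between two
  vectors as described must fix the sum 1, and it cannot exchange 2 and 3, since some prefix of the
  first vector sums to 2 and no prefix of the second one sums to 3.
\<close>

section \<open>Colors\<close>

text \<open>Colors are treated as atomic values; splitting a quantified color into two bits would only
  obscure the goals.\<close>

declare split_paired_All [simp del] split_paired_Ex [simp del]

lemma color_cases:
  fixes x :: color
  obtains "x = 0" | "x = col1" | "x = col2" | "x = col3"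
  by (cases x; cases "fst x"; cases "snd x") (auto simp: zero_prod_def)

lemma color_double [simp]: "(x::color) + x = 0"
  by (cases x rule: color_cases) (simp_all add: zero_prod_def)

lemma color_cancel [simp]: "(x::color) + (x + y) = y"
  by (simp add: add.assoc[symmetric])

lemma color_add_eq_iff: "(x::color) + y = z \<longleftrightarrow> y = x + z"
  by auto

lemma colors123_iff: "x \<in> colors123 \<longleftrightarrow> x \<noteq> (0::color)"
  by (cases x rule: color_cases) (simp_all add: zero_prod_def)

text \<open>The three colors around an internal vertex, in the order parent, left, right.\<close>

definition frame :: "color \<Rightarrow> color \<Rightarrow> color \<Rightarrow> bool" where
  "frame k a b \<longleftrightarrow> a \<noteq> 0 \<and> b \<noteq> 0 \<and> a \<noteq> b \<and> k = a + b"

lemma frame_iff_distinct: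
  "frame k a b \<longleftrightarrow> k \<in> colors123 \<and> a \<in> colors123 \<and> b \<in> colors123 \<and> distinct [k, a, b]"
  unfolding frame_def
  by (cases k rule: color_cases; cases a rule: color_cases; cases b rule: color_cases)
    (simp_all add: zero_prod_def)

lemma frame_left: "frame k a b \<Longrightarrow> frame a k b"
  and frame_right: "frame k a b \<Longrightarrow> frame b a k"
  by (auto simp: frame_iff_distinct)

lemma frame_nonzero: "frame k a b \<Longrightarrow> k \<noteq> 0 \<and> a \<noteq> 0 \<and> b \<noteq> 0"
  unfolding frame_iff_distinct colors123_iff by blast

lemma frame_cases:
  assumes "frame k a b"
  obtains "x = 0" | "x = k" | "x = a" | "x = b"
  using assms unfolding frame_iff_distinct
  by (cases x rule: color_cases) auto

lemma frame_123: "frame col1 col2 col3"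
  by (simp add: frame_iff_distinct)

definition orientation :: "color \<Rightarrow> color \<Rightarrow> color \<Rightarrow> sign" where
  "orientation k a b =
     (if (k, a, b) \<in> {(col1, col2, col3), (col2, col3, col1), (col3, col1, col2)}
      then Plus else Minus)"

text \<open>The two frames below are those of the children of a vertex with frame \<open>(k, a, b)\<close> in a rigid
  tree. Each is obtained by a transposition, which is why it has the opposite sign.\<close>

lemma orientation_left: "frame k a b \<Longrightarrow> orientation a k b \<noteq> orientation k a b"
  and orientation_right: "frame k a b \<Longrightarrow> orientation b a k \<noteq> orientation k a b"
  unfolding frame_iff_distinct orientation_def by auto

lemma orientation_inject:
  "frame k a b \<Longrightarrow> frame k a' b' \<Longrightarrow> orientation k a' b' = orientation k a b \<Longrightarrow> a' = a \<and> b' = b"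
  unfolding frame_iff_distinct orientation_def by (auto split: if_splits)

lemma sign_neq_trans: "x \<noteq> z \<Longrightarrow> y \<noteq> z \<Longrightarrow> x = (y :: sign)"
  by (cases x; cases y; cases z) auto

section \<open>Edge colorings of composed trees\<close>

lemma edge_coloring_spec:
  assumes "length c = num_leaves t"
  shows "is_edge_coloring t c (edge_coloring t c)"
    and "v \<notin> vertices t \<Longrightarrow> edge_coloring t c v = 0"
  using theI'[OF edge_coloring_unique_exists[OF assms]]
  unfolding edge_coloring_def[symmetric] by blast+

lemma edge_coloring_eqI:
  assumes "length c = num_leaves t" "is_edge_coloring t c \<kappa>" "\<And>v. v \<notin> vertices t \<Longrightarrow> \<kappa> v = 0"
  shows "edge_coloring t c = \<kappa>"
  unfolding edge_coloring_def
  using the1_equality[OF edge_coloring_unique_exists[OF assms(1)]] assms(2,3) by blast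

lemma edge_coloring_root: "length c = num_leaves t \<Longrightarrow> edge_coloring t c [] = sum_list c"
  using root_color_eq_sum_list by (simp add: root_color_def)

lemma edge_coloring_Node:
  assumes "length u = num_leaves l" "length v = num_leaves r"
  shows "edge_coloring (Node l r) (u @ v) (L # w) = edge_coloring l u w"
    and "edge_coloring (Node l r) (u @ v) (R # w) = edge_coloring r v w"
proof -
  let ?\<kappa> = "edge_coloring (Node l r) (u @ v)"
  have len: "length (u @ v) = num_leaves (Node l r)"
    using assms by simp
  have "is_edge_coloring l u (\<lambda>w. ?\<kappa> (L # w))" "is_edge_coloring r v (\<lambda>w. ?\<kappa> (R # w))"
    using edge_coloring_spec(1)[OF len] assms unfolding is_edge_coloring_Node[OF len] by auto
  moreover have "?\<kappa> (L # w) = 0" if "w \<notin> vertices l" for w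
    by (rule edge_coloring_spec(2)[OF len]) (use that in auto)
  moreover have "?\<kappa> (R # w) = 0" if "w \<notin> vertices r" for w
    by (rule edge_coloring_spec(2)[OF len]) (use that in auto)
  ultimately have "edge_coloring l u = (\<lambda>w. ?\<kappa> (L # w))" "edge_coloring r v = (\<lambda>w. ?\<kappa> (R # w))"
    using assms by (auto intro!: edge_coloring_eqI)
  then show "?\<kappa> (L # w) = edge_coloring l u w" "?\<kappa> (R # w) = edge_coloring r v w"
    by simp_all
qed

lemma valid_Node:
  assumes "length u = num_leaves l" "length v = num_leaves r"
  shows "valid (Node l r) (u @ v) \<longleftrightarrow>
    valid l u \<and> valid r v \<and> frame (sum_list u + sum_list v) (sum_list u) (sum_list v)"
proof -
  have Nil: "[] \<in> vertices t" for t by (cases t) auto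
  have root: "edge_coloring (Node l r) (u @ v) [] = sum_list u + sum_list v"
    using edge_coloring_root[of "u @ v" "Node l r"] assms by simp
  show ?thesis
    unfolding valid_def frame_iff_distinct
    using Nil[of l] Nil[of r] assms edge_coloring_root[OF assms(1)] edge_coloring_root[OF assms(2)]
    by (auto simp: ball_Un edge_coloring_Node[OF assms] root simp del: insert_iff)
qed

lemma derived_sign_orientation:
  "derived_sign t c v = orientation (edge_coloring t c v)
     (edge_coloring t c (v @ [L])) (edge_coloring t c (v @ [R]))"
  unfolding derived_sign_def orientation_def ..

lemma derived_sign_Node:
  assumes "length u = num_leaves l" "length v = num_leaves r"
  shows "derived_sign (Node l r) (u @ v) [] =
      orientation (sum_list u + sum_list v) (sum_list u) (sum_list v)"
    and "derived_sign (Node l r) (u @ v) (L # w) = derived_sign l u w"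
    and "derived_sign (Node l r) (u @ v) (R # w) = derived_sign r v w"
  using edge_coloring_root[of "u @ v" "Node l r"] assms
  by (simp_all add: derived_sign_orientation edge_coloring_Node edge_coloring_root)

lemma Nil_in_internal_iff: "[] \<in> internal t \<longleftrightarrow> t \<noteq> Leaf"
  by (cases t) auto

lemma rigid_Node:
  "rigid (Node l r) s \<longleftrightarrow>
    rigid l (\<lambda>w. s (L # w)) \<and> rigid r (\<lambda>w. s (R # w)) \<and>
    (l \<noteq> Leaf \<longrightarrow> s [L] \<noteq> s []) \<and> (r \<noteq> Leaf \<longrightarrow> s [R] \<noteq> s [])"
proof -
  have dir: "(\<forall>d. P d) \<longleftrightarrow> P L \<and> P R" for P by (metis dir.exhaust)
  have list: "(\<forall>v::vertex. P v) \<longleftrightarrow> P [] \<and> (\<forall>w. P (L # w)) \<and> (\<forall>w. P (R # w))" for P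
    by (metis dir.exhaust list.exhaust)
  show ?thesis
    unfolding rigid_def dir
    by (subst list) (auto simp: image_iff Nil_in_internal_iff)
qed

section \<open>Rigid trees as derivations of a grammar\<close>

text \<open>The last two arguments are the colors that the two top edges below the root edge have, or would
  have in case of a leaf. The grammar thus needs no mention of signs.\<close>

fun rigid_word :: "btree \<Rightarrow> color list \<Rightarrow> color \<Rightarrow> color \<Rightarrow> color \<Rightarrow> bool" where
  "rigid_word Leaf c k a b \<longleftrightarrow> c = [k]"
| "rigid_word (Node l r) c k a b \<longleftrightarrow>
     (\<exists>u v. c = u @ v \<and> rigid_word l u a k b \<and> rigid_word r v b a k)"

lemma valid_Leaf: "valid Leaf c \<longleftrightarrow> (\<exists>k. c = [k] \<and> k \<noteq> 0)"
proof (cases "length c = num_leaves Leaf")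
  case True
  then obtain k where "c = [k]" by (auto simp: length_Suc_conv)
  with edge_coloring_root[OF True] show ?thesis
    by (simp add: valid_def colors123_iff del: insert_iff)
qed (auto simp: valid_def)

text \<open>The grammar describes exactly the rigid trees: a frame is determined by its first color and
  its orientation, and the opposite of the orientation of \<open>(k, a, b)\<close> is that of both frames used in
  the production. A leaf has no sign, hence the restriction to \<open>t \<noteq> Leaf\<close>.\<close>

lemma rigid_word_iff:
  assumes "frame k a b"
  shows "rigid_word t c k a b \<longleftrightarrow>
    valid t c \<and> sum_list c = k \<and> rigid t (derived_sign t c) \<and>
    (t \<noteq> Leaf \<longrightarrow> derived_sign t c [] = orientation k a b)"
  using assms
proof (induction t arbitrary: c k a b)
  case Leaf
  then show ?case
    using frame_nonzero[OF Leaf] by (auto simp: valid_Leaf rigid_def)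
next
  case (Node l r)
  note fr = Node.prems
  note IH = Node.IH(1)[OF frame_left[OF fr]] Node.IH(2)[OF frame_right[OF fr]]
  show ?case
  proof
    assume "rigid_word (Node l r) c k a b"
    then obtain u v where c: "c = u @ v" and l: "rigid_word l u a k b" and r: "rigid_word r v b a k"
      by auto
    note l = l[unfolded IH] and r = r[unfolded IH]
    have len: "length u = num_leaves l" "length v = num_leaves r"
      using l r by (auto simp: valid_def)
    show "valid (Node l r) c \<and> sum_list c = k \<and> rigid (Node l r) (derived_sign (Node l r) c) \<and>
      (Node l r \<noteq> Leaf \<longrightarrow> derived_sign (Node l r) c [] = orientation k a b)"
      using l r fr orientation_left[OF fr] orientation_right[OF fr]
      unfolding c by (simp add: valid_Node[OF len] derived_sign_Node[OF len] rigid_Node)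
        (auto simp: frame_def)
  next
    assume *: "valid (Node l r) c \<and> sum_list c = k \<and> rigid (Node l r) (derived_sign (Node l r) c) \<and>
      (Node l r \<noteq> Leaf \<longrightarrow> derived_sign (Node l r) c [] = orientation k a b)"
    define u v where "u = take (num_leaves l) c" and "v = drop (num_leaves l) c"
    have c: "c = u @ v" by (simp add: u_def v_def)
    have len: "length u = num_leaves l" "length v = num_leaves r"
      using * by (auto simp: u_def v_def valid_def)
    note * = *[unfolded c valid_Node[OF len] derived_sign_Node[OF len] rigid_Node]
    have sums: "sum_list u = a \<and> sum_list v = b"
      using * by (intro orientation_inject[OF fr]) auto
    have opposite: "l \<noteq> Leaf \<Longrightarrow> derived_sign l u [] \<noteq> orientation k a b"
      "r \<noteq> Leaf \<Longrightarrow> derived_sign r v [] \<noteq> orientation k a b"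
      using * by auto
    have "l \<noteq> Leaf \<Longrightarrow> derived_sign l u [] = orientation a k b"
      "r \<noteq> Leaf \<Longrightarrow> derived_sign r v [] = orientation b a k"
      using sign_neq_trans[OF opposite(1) orientation_left[OF fr]]
        sign_neq_trans[OF opposite(2) orientation_right[OF fr]] by blast+
    then have "rigid_word l u a k b" "rigid_word r v b a k"
      unfolding IH using * sums by blast+
    then show "rigid_word (Node l r) c k a b"
      using c by auto
  qed
qed

section \<open>The words that rigid trees produce\<close>

definition nonconstant :: "'a list \<Rightarrow> bool" where
  "nonconstant c \<longleftrightarrow> (\<exists>x \<in> set c. \<exists>y \<in> set c. x \<noteq> y)"

text \<open>The empty prefix is included among the prefixes; this changes nothing for \<open>b \<noteq> 0\<close>.\<close>

definition admissible :: "color \<Rightarrow> color \<Rightarrow> color list \<Rightarrow> bool" where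
  "admissible k b c \<longleftrightarrow> 0 \<notin> set c \<and> sum_list c = k \<and> (\<forall>j. sum_list (take j c) \<noteq> b)"

text \<open>Every color has order at most two, so a constant word sums to 0 or to its only letter.\<close>

lemma sum_constant: "\<not> nonconstant c \<Longrightarrow> sum_list c \<noteq> 0 \<Longrightarrow> set c = {sum_list c}"
  for c :: "color list"
proof -
  assume const: "\<not> nonconstant c" and nz: "sum_list c \<noteq> 0"
  then obtain x where x: "x \<in> set c" by (cases c) auto
  with const have sub: "set c \<subseteq> {x}" by (auto simp: nonconstant_def)
  then have "sum_list c \<in> {0, x}" by (induction c) auto
  with nz x sub show "set c = {sum_list c}" by auto
qed

text \<open>A prefix that reaches into \<open>v\<close> has sum \<open>a + s\<close> with \<open>s\<close> the sum of a prefix of \<open>v\<close>. As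
  \<open>a + s = b\<close> means \<open>s = k\<close>, forbidding \<open>b\<close> for the concatenation amounts to forbidding \<open>b\<close> for
  \<open>u\<close> and \<open>k\<close> for \<open>v\<close>. The same computation gives the converse below.\<close>

lemma admissible_append:
  assumes "frame k a b" "admissible a b u" "admissible b k v"
  shows "admissible k b (u @ v)"
proof -
  have "sum_list (take j (u @ v)) \<noteq> b" for j
  proof (cases "j \<le> length u")
    case True
    then show ?thesis using assms by (simp add: admissible_def)
  next
    case False
    then have "sum_list (take j (u @ v)) = a + sum_list (take (j - length u) v)"
      using assms by (simp add: admissible_def)
    then show ?thesis
      using assms by (auto simp: admissible_def frame_def color_add_eq_iff)
  qed
  then show ?thesis using assms by (auto simp: admissible_def frame_def)
qed

lemma admissible_appendD:
  assumes "frame k a b" "admissible k b (u @ v)" "sum_list u = a"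
  shows "admissible a b u" "admissible b k v"
proof -
  have "sum_list (take j u) \<noteq> b" for j
  proof -
    have "sum_list (take (min j (length u)) (u @ v)) \<noteq> b"
      using assms(2) unfolding admissible_def by blast
    then show ?thesis by (simp add: min_def split: if_splits)
  qed
  then show "admissible a b u" using assms by (simp add: admissible_def)
  have "sum_list (take j v) \<noteq> k" for j
  proof -
    have "sum_list (take (length u + j) (u @ v)) \<noteq> b"
      using assms(2) unfolding admissible_def by blast
    then show ?thesis using assms by (auto simp: frame_def)
  qed
  then show "admissible b k v" using assms by (auto simp: admissible_def frame_def)
qed

text \<open>If the prefix sums avoided \<open>a\<close> as well as \<open>b\<close>, they would stay in \<open>{0, k}\<close>; each letter is the
  difference of two consecutive ones and not 0, so all letters would be \<open>k\<close>.\<close>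

lemma nonconstant_reaches_third:
  assumes fr: "frame k a b" and adm: "admissible k b c" and nc: "nonconstant c"
  obtains j where "sum_list (take j c) = a"
proof (rule ccontr)
  assume "\<not> thesis"
  then have "sum_list (take j c) \<noteq> a" for j using that by blast
  then have two: "sum_list (take j c) \<in> {0, k}" for j
    using adm by (cases "sum_list (take j c)" rule: frame_cases[OF fr]) (auto simp: admissible_def)
  have "c ! j = k" if "j < length c" for j
  proof -
    have "c ! j = sum_list (take j c) + sum_list (take (Suc j) c)"
      using that by (simp add: take_Suc_conv_app_nth)
    then have "c ! j \<in> {0, k}"
      using two[of j] two[of "Suc j"] by auto
    then show ?thesis
      using adm nth_mem[OF that] unfolding admissible_def by (metis insertE singletonD)
  qed
  then show False using nc by (auto simp: nonconstant_def in_set_conv_nth)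
qed

text \<open>By \<open>admissible_appendD\<close> any cut after a prefix with sum \<open>a\<close> works, unless it leaves a constant
  factor of length at least two. A constant left factor consists of letters \<open>a\<close>, so the word begins
  with \<open>a\<close> and can be cut after its first letter; a constant right factor consists of letters
  \<open>b\<close>, so the word ends in \<open>b\<close> and can be cut before its last letter. If the first of these cuts
  leaves a constant right factor, the second one leaves a left factor that is \<open>a\<close> alone or contains
  both letters. If neither end has this form, any visit to \<open>a\<close> will do.\<close>

lemma admissible_split:
  assumes fr: "frame k a b" and adm: "admissible k b c" and nc: "nonconstant c"
  obtains u v where "c = u @ v" "admissible a b u" "u = [a] \<or> nonconstant u"
    "admissible b k v" "v = [b] \<or> nonconstant v"
proof -
  have nz: "a \<noteq> 0" "b \<noteq> 0" "a \<noteq> b" using fr by (auto simp: frame_def)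
  have "\<exists>u v. c = u @ v \<and> sum_list u = a \<and> (u = [a] \<or> nonconstant u) \<and> (v = [b] \<or> nonconstant v)"
  proof (cases "\<exists>w. c = a # w")
    case True
    then obtain w where c: "c = a # w" by blast
    then have w: "sum_list w = b" using adm fr by (auto simp: admissible_def frame_def)
    show ?thesis
    proof (cases "nonconstant w")
      case True
      with c show ?thesis by (intro exI[of _ "[a]"] exI[of _ w]) auto
    next
      case False
      with w nz have set: "set w = {b}" using sum_constant by metis
      then obtain w' where w': "w = w' @ [b]" by (cases w rule: rev_cases) auto
      have "nonconstant (a # w')" if "w' \<noteq> []"
        using that set nz unfolding w' by (cases w') (auto simp: nonconstant_def)
      moreover have "sum_list (a # w') = a"
        using w w' by (auto simp: color_add_eq_iff add.commute)
      ultimately show ?thesis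
        using c w' by (intro exI[of _ "a # w'"] exI[of _ "[b]"]) auto
    qed
  next
    case hd: False
    have left: "nonconstant u" if "c = u @ v" "sum_list u = a" for u v
    proof (rule ccontr)
      assume "\<not> nonconstant u"
      with that nz have "set u = {a}" using sum_constant by metis
      with that hd show False by (cases u) auto
    qed
    show ?thesis
    proof (cases "\<exists>w. c = w @ [b]")
      case True
      then obtain w where c: "c = w @ [b]" by blast
      then have "sum_list w = a"
        using adm fr by (auto simp: admissible_def frame_def)
      with left c show ?thesis by blast
    next
      case last: False
      obtain j where j: "sum_list (take j c) = a"
        using nonconstant_reaches_third[OF fr adm nc] .
      have "sum_list c = a + sum_list (drop j c)"
        using j by (metis append_take_drop_id sum_list_append)
      then have sum: "sum_list (drop j c) = b"
        using adm fr by (auto simp: admissible_def frame_def)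
      have "nonconstant (drop j c)"
      proof (rule ccontr)
        assume "\<not> nonconstant (drop j c)"
        with sum nz have set: "set (drop j c) = {b}" using sum_constant by metis
        then obtain w x where w: "drop j c = w @ [x]" by (cases "drop j c" rule: rev_cases) auto
        with set have "x = b" by auto
        with w last show False by (metis append_assoc append_take_drop_id)
      qed
      with left j show ?thesis by (metis append_take_drop_id)
    qed
  qed
  then show ?thesis
    using admissible_appendD[OF fr] adm that by metis
qed

text \<open>A concatenation of words with the different nonzero sums \<open>a\<close> and \<open>b\<close> cannot be constant,
  because \<open>a\<close> would be the only letter of the left factor and \<open>b\<close> that of the right one.\<close>

lemma rigid_word_sound:
  assumes "frame k a b" "rigid_word t c k a b"
  shows "admissible k b c \<and> (c = [k] \<or> nonconstant c)"
  using assms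
proof (induction t arbitrary: c k a b)
  case Leaf
  then show ?case
    using frame_nonzero[OF Leaf(1)] by (auto simp: admissible_def take_Cons' frame_def)
next
  case (Node l r)
  note fr = Node.prems(1)
  obtain u v where c: "c = u @ v" and "rigid_word l u a k b" "rigid_word r v b a k"
    using Node.prems(2) by auto
  then have u: "admissible a b u" and v: "admissible b k v"
    using Node.IH fr frame_left frame_right by blast+
  have "nonconstant c"
  proof (rule ccontr)
    assume "\<not> nonconstant c"
    then have "\<not> nonconstant u" "\<not> nonconstant v" unfolding c by (auto simp: nonconstant_def)
    then have "set u = {a}" "set v = {b}"
      using u v fr sum_constant by (metis admissible_def frame_def)+
    then show False using \<open>\<not> nonconstant c\<close> fr by (auto simp: c nonconstant_def frame_def)
  qed
  then show ?case using admissible_append[OF fr u v] c by simp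
qed

lemma rigid_word_complete:
  assumes "frame k a b" "admissible k b c" "c = [k] \<or> nonconstant c"
  shows "\<exists>t. rigid_word t c k a b"
  using assms
proof (induction c arbitrary: k a b rule: length_induct)
  case (1 c)
  note fr = \<open>frame k a b\<close>
  show ?case
  proof (cases "c = [k]")
    case True
    then show ?thesis by (intro exI[of _ Leaf]) simp
  next
    case False
    then obtain u v where c: "c = u @ v"
      and u: "admissible a b u" "u = [a] \<or> nonconstant u"
      and v: "admissible b k v" "v = [b] \<or> nonconstant v"
      using 1 admissible_split[OF fr] by metis
    have "u \<noteq> []" "v \<noteq> []" using u v by (auto simp: nonconstant_def)
    then have "length u < length c" "length v < length c" using c by auto
    then obtain l r where "rigid_word l u a k b" "rigid_word r v b a k"
      using 1(1) u v frame_left[OF fr] frame_right[OF fr] by metis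
    with c have "rigid_word (Node l r) c k a b" by auto
    then show ?thesis ..
  qed
qed

section \<open>Permuting the colors\<close>

lemma rigid_word_map: "rigid_word t c k a b \<Longrightarrow> rigid_word t (map \<pi> c) (\<pi> k) (\<pi> a) (\<pi> b)"
  by (induction t arbitrary: c k a b) (auto, metis map_append)

text \<open>The sum of two different nonzero colors is the third one, so every permutation of the nonzero
  colors is an automorphism of the group of colors.\<close>

lemma color_permutation_add:
  assumes "\<pi> permutes colors123"
  shows "\<pi> 0 = 0" "\<pi> (x + y) = \<pi> x + \<pi> y"
proof -
  show zero: "\<pi> 0 = 0"
    using assms colors123_iff[of 0] permutes_not_in by fastforce
  show "\<pi> (x + y) = \<pi> x + \<pi> y"
  proof (cases "x = 0 \<or> y = 0 \<or> x = y")
    case True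
    then show ?thesis using zero by auto
  next
    case False
    then have "frame (x + y) x y" by (simp add: frame_def)
    then have "frame (\<pi> (x + y)) (\<pi> x) (\<pi> y)"
      unfolding frame_iff_distinct
      using permutes_in_image[OF assms] permutes_inj[OF assms] by (simp add: inj_eq)
    then show ?thesis by (simp add: frame_def)
  qed
qed

lemma color_permutation_sum_list:
  "\<pi> permutes colors123 \<Longrightarrow> sum_list (map \<pi> c) = \<pi> (sum_list c)"
  by (induction c) (simp_all add: color_permutation_add)

lemma S3_orbit_map:
  assumes "\<pi> permutes colors123"
  shows "S3_orbit (map \<pi> c) = S3_orbit c"
proof
  show "S3_orbit (map \<pi> c) \<subseteq> S3_orbit c"
  proof
    fix d assume "d \<in> S3_orbit (map \<pi> c)"
    then obtain \<sigma> where "\<sigma> permutes colors123" "d = map (\<sigma> \<circ> \<pi>) c"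
      by (auto simp: S3_orbit_def)
    then show "d \<in> S3_orbit c"
      using permutes_compose[OF assms] unfolding S3_orbit_def by blast
  qed
  show "S3_orbit c \<subseteq> S3_orbit (map \<pi> c)"
  proof
    fix d assume "d \<in> S3_orbit c"
    then obtain \<sigma> where s: "\<sigma> permutes colors123" "d = map \<sigma> c"
      by (auto simp: S3_orbit_def)
    have "d = map (\<sigma> \<circ> inv \<pi>) (map \<pi> c)"
      using s(2) permutes_inverses(2)[OF assms] by simp
    moreover have "\<sigma> \<circ> inv \<pi> permutes colors123"
      using permutes_compose[OF permutes_inv[OF assms] s(1)] .
    ultimately show "d \<in> S3_orbit (map \<pi> c)"
      unfolding S3_orbit_def by blast
  qed
qed

text \<open>A permutation carrying \<open>c\<close> to \<open>d\<close> fixes the common sum \<open>k\<close>. Some prefix of \<open>c\<close> sums to \<open>a\<close>; its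
  image is a prefix of \<open>d\<close>, whose sum is not \<open>b\<close>. Hence \<open>a\<close> is fixed, and so is every color.\<close>

lemma admissible_orbit_unique:
  assumes fr: "frame k a b" and c: "admissible k b c" "nonconstant c"
    and d: "admissible k b d" and orbit: "S3_orbit c = S3_orbit d"
  shows "c = d"
proof -
  have "d \<in> S3_orbit d"
    unfolding S3_orbit_def by (auto intro!: exI[of _ id] permutes_id)
  then obtain \<pi> where p: "\<pi> permutes colors123" and d_eq: "d = map \<pi> c"
    using orbit by (auto simp: S3_orbit_def)
  have pk: "\<pi> k = k"
    using c d color_permutation_sum_list[OF p, of c] by (simp add: admissible_def d_eq)
  obtain j where "sum_list (take j c) = a"
    using nonconstant_reaches_third[OF fr c] .
  then have "sum_list (take j d) = \<pi> a"
    using color_permutation_sum_list[OF p, of "take j c"] by (simp add: d_eq take_map)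
  then have "\<pi> a \<noteq> b" using d by (auto simp: admissible_def)
  moreover have "\<pi> a \<noteq> k" "\<pi> a \<noteq> 0"
    using pk fr frame_nonzero[OF fr] color_permutation_add(1)[OF p] permutes_inj[OF p]
    unfolding frame_iff_distinct by (metis distinct_length_2_or_more injD)+
  ultimately have pa: "\<pi> a = a"
    using frame_cases[OF fr, of "\<pi> a"] by metis
  have pb: "\<pi> b = b"
    using color_permutation_add(2)[OF p, of k a] pk pa fr
    by (simp add: frame_def add.commute)
  have "\<pi> x = x" for x
    using frame_cases[OF fr, of x] color_permutation_add(1)[OF p] pk pa pb by metis
  then show ?thesis by (simp add: d_eq map_idI)
qed

lemma cyclic_permutation_to_123:
  assumes "orientation k a b = Plus"
  obtains \<pi> where "\<pi> permutes colors123" "\<pi> k = col1" "\<pi> a = col2" "\<pi> b = col3"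
proof -
  have cyc: "(k, a, b) \<in> {(col1, col2, col3), (col2, col3, col1), (col3, col1, col2)}"
    using assms by (auto simp: orientation_def split: if_splits)
  define \<pi> where "\<pi> = (\<lambda>x. if x = k then col1 else if x = a then col2 else if x = b then col3 else x)"
  have "bij_betw \<pi> colors123 colors123"
    using cyc by (auto simp: bij_betw_def inj_on_def \<pi>_def)
  then have "\<pi> permutes colors123"
    using cyc by (intro bij_imp_permutes) (auto simp: \<pi>_def)
  moreover have "\<pi> k = col1" "\<pi> a = col2" "\<pi> b = col3"
    using cyc by (auto simp: \<pi>_def)
  ultimately show ?thesis using that by blast
qed

section \<open>Positive rigid vectors\<close>

text \<open>The frame \<open>(k, a, b)\<close> is the one found at the top vertex of the tree.\<close>

lemma positive_rigid_on_iff: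
  "positive_rigid_on t c \<and> root_color t c = k \<longleftrightarrow>
    t \<noteq> Leaf \<and> (\<exists>a b. frame k a b \<and> orientation k a b = Plus \<and> rigid_word t c k a b)"
  (is "?lhs \<longleftrightarrow> ?rhs")
proof
  assume ?lhs
  then have *: "valid t c" "t \<noteq> Leaf" "derived_sign t c [] = Plus" "rigid t (derived_sign t c)"
    "sum_list c = k"
    using root_color_eq_sum_list[of c t]
    by (simp_all add: positive_rigid_on_def positive_rigid_def Nil_in_internal_iff valid_def)
  then obtain l r where t: "t = Node l r" by (cases t) auto
  define u v where "u = take (num_leaves l) c" and "v = drop (num_leaves l) c"
  have c: "c = u @ v" by (simp add: u_def v_def)
  have len: "length u = num_leaves l" "length v = num_leaves r"
    using * t by (auto simp: u_def v_def valid_def)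
  have "frame k (sum_list u) (sum_list v)" "orientation k (sum_list u) (sum_list v) = Plus"
    using * unfolding t c by (auto simp: valid_Node[OF len] derived_sign_Node[OF len])
  then show ?rhs
    using * rigid_word_iff by metis
next
  assume ?rhs
  then obtain a b where "t \<noteq> Leaf" "frame k a b" "orientation k a b = Plus" "rigid_word t c k a b"
    by blast
  then have "t \<noteq> Leaf" "valid t c" "sum_list c = k" "rigid t (derived_sign t c)"
    "derived_sign t c [] = Plus"
    by (simp_all add: rigid_word_iff)
  moreover from \<open>valid t c\<close> have "root_color t c = sum_list c"
    by (intro root_color_eq_sum_list) (simp add: valid_def)
  ultimately show ?lhs
    by (simp add: positive_rigid_on_def positive_rigid_def Nil_in_internal_iff)
qed

lemma positive_rigid_vector_root1_iff:
  assumes "length c \<ge> 2"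
  shows "positive_rigid_vector_with_root_color c col1 \<longleftrightarrow>
    admissible col1 col3 c \<and> nonconstant c"
proof -
  have "frame col1 a b \<and> orientation col1 a b = Plus \<longleftrightarrow> a = col2 \<and> b = col3" for a b
    by (auto simp: frame_iff_distinct orientation_def)
  then have "positive_rigid_vector_with_root_color c col1 \<longleftrightarrow>
      (\<exists>t. t \<noteq> Leaf \<and> rigid_word t c col1 col2 col3)"
    unfolding positive_rigid_vector_with_root_color_def positive_rigid_on_iff by metis
  also have "\<dots> \<longleftrightarrow> (\<exists>t. rigid_word t c col1 col2 col3)"
  proof -
    have "\<not> rigid_word Leaf c col1 col2 col3" using assms by auto
    then show ?thesis by metis
  qed
  also have "\<dots> \<longleftrightarrow> admissible col1 col3 c \<and> nonconstant c"
  proof -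
    have "c \<noteq> [col1]" using assms by auto
    then show ?thesis
      using rigid_word_sound[OF frame_123] rigid_word_complete[OF frame_123] by blast
  qed
  finally show ?thesis .
qed

lemma positive_rigid_vector_orbit:
  assumes "positive_rigid_vector c"
  obtains d where "positive_rigid_vector_with_root_color d col1"
    "S3_orbit d = S3_orbit c" "length d = length c"
proof -
  obtain t k a b where t: "t \<noteq> Leaf" and or: "orientation k a b = Plus"
    and word: "rigid_word t c k a b"
    using assms positive_rigid_on_iff unfolding positive_rigid_vector_def by blast
  obtain \<pi> where p: "\<pi> permutes colors123" "\<pi> k = col1" "\<pi> a = col2" "\<pi> b = col3"
    using cyclic_permutation_to_123[OF or] .
  then have "rigid_word t (map \<pi> c) col1 col2 col3"
    using rigid_word_map[OF word, of \<pi>] by simp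
  moreover have "orientation col1 col2 col3 = Plus" by (simp add: orientation_def)
  ultimately have "positive_rigid_vector_with_root_color (map \<pi> c) col1"
    unfolding positive_rigid_vector_with_root_color_def positive_rigid_on_iff
    using t frame_123 by blast
  then show ?thesis
    using that[of "map \<pi> c"] S3_orbit_map[OF p(1)] by simp
qed

text \<open>Prefixes longer than the word are the word itself, whose sum is 1 rather than 3, and the empty
  prefix sums to 0.\<close>

lemma prefix_condition_iff:
  assumes "length c = n"
  shows "set c \<subseteq> colors123 \<and> (\<exists>i < n. \<exists>j < n. c ! i \<noteq> c ! j) \<and> sum_list c = col1 \<and>
      (\<forall>j. 1 \<le> j \<and> j \<le> n \<longrightarrow> sum_list (take j c) \<noteq> col3) \<longleftrightarrow>
    admissible col1 col3 c \<and> nonconstant c"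
proof -
  have "set c \<subseteq> colors123 \<longleftrightarrow> 0 \<notin> set c"
    unfolding subset_iff colors123_iff by blast
  moreover have "(\<exists>i < n. \<exists>j < n. c ! i \<noteq> c ! j) \<longleftrightarrow> nonconstant c"
    unfolding nonconstant_def set_conv_nth using assms by blast
  moreover have "(\<forall>j. 1 \<le> j \<and> j \<le> n \<longrightarrow> sum_list (take j c) \<noteq> col3) \<longleftrightarrow>
      (\<forall>j. sum_list (take j c) \<noteq> col3)" if "sum_list c = col1"
  proof (intro iffI allI)
    fix j assume *: "\<forall>j. 1 \<le> j \<and> j \<le> n \<longrightarrow> sum_list (take j c) \<noteq> col3"
    consider "j = 0" | "1 \<le> j \<and> j \<le> n" | "j > n" by linarith
    then show "sum_list (take j c) \<noteq> col3"
      using * that assms by cases (auto simp: zero_prod_def)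
  qed auto
  ultimately show ?thesis
    unfolding admissible_def by blast
qed

theorem proposition9p4:
  fixes n :: nat
  assumes "n \<ge> 2"
  shows "(\<forall>c :: color list. length c = n \<and> set c \<subseteq> colors123 \<longrightarrow>
            (positive_rigid_vector_with_root_color c col1 \<longleftrightarrow>
               (\<exists>i < n. \<exists>j < n. c ! i \<noteq> c ! j) \<and> sum_list c = col1 \<and>
               (\<forall>j. 1 \<le> j \<and> j \<le> n \<longrightarrow> sum_list (take j c) \<noteq> col3)))
       \<and> bij_betw S3_orbit
           {c. length c = n \<and> set c \<subseteq> colors123 \<and>
               (\<exists>i < n. \<exists>j < n. c ! i \<noteq> c ! j) \<and> sum_list c = col1 \<and>
               (\<forall>j. 1 \<le> j \<and> j \<le> n \<longrightarrow> sum_list (take j c) \<noteq> col3)}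
           (S3_orbit ` {c. length c = n \<and> positive_rigid_vector c})"
  (is "(\<forall>c. length c = n \<and> ?colors c \<longrightarrow> (_ \<longleftrightarrow> ?cond c)) \<and> bij_betw _ ?A _")
proof
  have root1: "positive_rigid_vector_with_root_color c col1 \<longleftrightarrow>
      admissible col1 col3 c \<and> nonconstant c" if "length c = n" for c
    using positive_rigid_vector_root1_iff that assms by blast
  show "\<forall>c. length c = n \<and> ?colors c \<longrightarrow>
      (positive_rigid_vector_with_root_color c col1 \<longleftrightarrow> ?cond c)"
    using prefix_condition_iff root1 by blast
  have A: "?A = {c. length c = n \<and> admissible col1 col3 c \<and> nonconstant c}"
    using prefix_condition_iff by blast
  show "bij_betw S3_orbit ?A (S3_orbit ` {c. length c = n \<and> positive_rigid_vector c})"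
    unfolding A
  proof (intro bij_betw_imageI)
    show "inj_on S3_orbit {c. length c = n \<and> admissible col1 col3 c \<and> nonconstant c}"
      using admissible_orbit_unique[OF frame_123] by (auto intro!: inj_onI)
    have "positive_rigid_vector c" if "length c = n" "admissible col1 col3 c" "nonconstant c" for c
      using root1 that
      unfolding positive_rigid_vector_def positive_rigid_vector_with_root_color_def by blast
    moreover have "\<exists>d. length d = n \<and> admissible col1 col3 d \<and> nonconstant d \<and>
        S3_orbit c = S3_orbit d" if "length c = n" "positive_rigid_vector c" for c
      using positive_rigid_vector_orbit[OF that(2)] root1 that(1) by metis
    ultimately show "S3_orbit ` {c. length c = n \<and> admissible col1 col3 c \<and> nonconstant c} =
        S3_orbit ` {c. length c = n \<and> positive_rigid_vector c}"
      by (auto simp: image_iff)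
  qed
qed

end
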